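(* For every $0<\delta<1$ there is a constant $c(\delta)<\infty$ depending only on $\delta$ such that the following holds. If $\mu$ is measurable with $|\mu|\leqslant\chi_{\mathbb{D}}$, then for all $1<R<2$, \[ \frac{1}{2\pi}\int_0^{2\pi}|\mathcal{S}\mu(Re^{i\theta})|^2\,d\theta\leqslant(1+\delta)\log\frac{1}{R-1}+c(\delta). \]
   Context: $\mathbb{D}$ is the unit disk; the Beurling transform is $\mathcal{S}\mu(z)=-\frac{1}{\pi}\,\mathrm{p.v.}\int_{\mathbb{C}}\frac{\mu(w)}{(z-w)^2}\,dm(w)$. *)

theory Defs
  imports "HOL-Analysis.Analysis"
begin

definition beurling_trunc :: "(complex \<Rightarrow> complex) \<Rightarrow> real \<Rightarrow> complex \<Rightarrow> complex" where
  "beurling_trunc \<mu> \<epsilon> z =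
     - (1 / complex_of_real pi) *
       (LINT w:{w. \<epsilon> < cmod (z - w)}|lebesgue. \<mu> w / (z - w)^2)"

definition beurling :: "(complex \<Rightarrow> complex) \<Rightarrow> complex \<Rightarrow> complex" where
  "beurling \<mu> z = Lim (at_right 0) (\<lambda>\<epsilon>. beurling_trunc \<mu> \<epsilon> z)"

end

(* Outside the disc, S mu(R e^{i t}) = sum_n a_n e^{-i (n + 2) t} with a_n = -(1/pi) (n + 1) A_n / R^(n + 2),
   where A_n is the n-th moment of mu, so the circular mean is X = sum |a_n|^2. By linearity in mu,
   X = -(1/pi) int_D mu h for an explicit polynomial h (after truncating the sum), hence pi X <= int_D |h|.
   By AM-GM, 2 |h| <= |h|^2 (R^2 - |w|^2) + 1 / (R^2 - |w|^2). The monomials are orthogonal for the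
   radial weight R^2 - |w|^2 and Bernoulli's inequality bounds the first term by pi X, while the second
   integrates to pi ln (R^2 / (R^2 - 1)). Therefore X <= ln (R^2 / (R^2 - 1)). *)

theory Submission
  imports Defs
begin

section \<open>Rotation invariance of Lebesgue measure on the complex plane\<close>

text \<open>Identifies the plane with \<open>real^2\<close>, where invariance under orthogonal maps
  can be applied. Both measures agree on boxes, because the preimage of a box is the box with the
  same sides.\<close>

lemma distr_lborel_vec2_complex:
  "distr lborel borel (\<lambda>v :: real^2. Complex (v $ 1) (v $ 2)) = lborel"
proof (rule lborel_eqI[symmetric])
  let ?p = "\<lambda>v :: real^2. Complex (v $ 1) (v $ 2)"
  fix l u :: complex
  assume le: "\<And>b. b \<in> Basis \<Longrightarrow> l \<bullet> b \<le> u \<bullet> b"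
  have [measurable]: "?p \<in> borel \<rightarrow>\<^sub>M borel"
    by (intro borel_measurable_continuous_onI) (auto intro!: continuous_intros simp: complex_eq_iff)
  let ?v = "\<lambda>z. vector [Re z, Im z] :: real^2"
  have ax: "(\<Prod>b\<in>(Basis :: (real^2) set). f b) = f (axis 1 1) * f (axis 2 1)" for f :: "real^2 \<Rightarrow> real"
  proof -
    have B: "(Basis :: (real^2) set) = {axis 1 1, axis 2 1}"
      by (auto simp: Basis_vec_def UNIV_2)
    have "(axis 1 1 :: real^2) \<noteq> axis 2 1"
      by (simp add: axis_eq_axis)
    then show ?thesis unfolding B by (subst prod.insert) auto
  qed
  have "?p -` box l u = box (?v l) (?v u)"
    by (auto simp: box_def Basis_vec_def Basis_complex_def inner_axis UNIV_2)
  moreover have "emeasure lborel (box (?v l) (?v u)) = ennreal (\<Prod>b\<in>Basis. (u - l) \<bullet> b)"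
  proof -
    have "\<forall>b\<in>Basis. ?v l \<bullet> b \<le> ?v u \<bullet> b"
      using le[of 1] le[of \<i>] by (auto simp: Basis_vec_def Basis_complex_def inner_axis UNIV_2)
    then show ?thesis
      by (simp add: emeasure_lborel_box_eq ax inner_axis) (simp add: Basis_complex_def)
  qed
  ultimately show "emeasure (distr lborel borel ?p) (box l u) = ennreal (\<Prod>b\<in>Basis. (u - l) \<bullet> b)"
    by (simp add: emeasure_distr)
qed simp

text \<open>Read in \<open>real^2\<close>, multiplication by a unimodular number is an orthogonal
  map, and such maps preserve the measure of boxes.\<close>

lemma distr_lborel_rotation:
  fixes \<zeta> :: complex
  assumes "cmod \<zeta> = 1"
  shows "distr lborel borel ((*) \<zeta>) = lborel"
proof (rule lborel_eqI[symmetric])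
  let ?p = "\<lambda>v :: real^2. Complex (v $ 1) (v $ 2)"
  let ?v = "\<lambda>z. vector [Re z, Im z] :: real^2"
  \<comment> \<open>\<open>T\<close> is the inverse rotation, multiplication by
    \<open>cnj \<zeta>\<close>. A preimage under multiplication by \<open>\<zeta>\<close> is then an
    image under \<open>T\<close>, the form that \<open>measure_orthogonal_image\<close>
    treats.\<close>
  define T where "T = (\<lambda>x. ?v (cnj \<zeta> * ?p x))"
  fix l u :: complex
  assume le: "\<And>b. b \<in> Basis \<Longrightarrow> l \<bullet> b \<le> u \<bullet> b"
  have [measurable]: "?p \<in> borel \<rightarrow>\<^sub>M borel"
    by (intro borel_measurable_continuous_onI) (auto intro!: continuous_intros simp: complex_eq_iff)
  have pv: "?p (?v z) = z" for z by simp
  have vp: "?v (?p x) = x" for x by (simp add: vec_eq_iff forall_2)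
  have z1: "\<zeta> * cnj \<zeta> = 1" using assms by (metis complex_norm_square of_real_1 one_power2)
  have z2: "cnj \<zeta> * (\<zeta> * y) = y" for y
    using z1 by (metis mult.assoc mult.commute mult_1)
  have T: "orthogonal_transformation T"
    unfolding orthogonal_transformation
  proof
    show "linear T"
      by (rule linearI) (auto simp: T_def vec_eq_iff forall_2 algebra_simps)
    have nv: "norm (?v z) = cmod z" for z
      by (simp add: norm_vec_def L2_set_def UNIV_2 cmod_def)
    show "\<forall>v. norm (T v) = norm v"
    proof
      fix v
      have "norm (T v) = cmod (?p v)"
        by (simp only: T_def nv norm_mult complex_mod_cnj assms mult_1)
      also have "\<dots> = norm (?v (?p v))" by (simp only: nv)
      finally show "norm (T v) = norm v" by (simp only: vp)
    qed
  qed
  let ?A = "?p -` box l u"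
  have eq: "?p -` ((*) \<zeta> -` box l u) = T ` ?A"
  proof (intro equalityI subsetI)
    fix x assume "x \<in> ?p -` ((*) \<zeta> -` box l u)"
    moreover have "T (?v (\<zeta> * ?p x)) = x"
      by (simp only: T_def pv z2 vp)
    ultimately show "x \<in> T ` ?A"
      by (intro image_eqI[of _ _ "?v (\<zeta> * ?p x)"]) (simp_all only: vimage_eq pv)
  next
    fix x assume "x \<in> T ` ?A"
    then obtain y where y: "x = T y" "?p y \<in> box l u" by auto
    have "\<zeta> * ?p x = ?p y"
      using z1 by (simp only: y T_def pv mult.assoc[symmetric] mult_1)
    then show "x \<in> ?p -` ((*) \<zeta> -` box l u)" using y by (simp only: vimage_eq)
  qed
  have A: "emeasure lborel ?A = emeasure lborel (box l u)"
    by (subst distr_lborel_vec2_complex[symmetric], subst emeasure_distr) auto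
  have Ab: "?A \<in> sets borel"
    using measurable_sets[OF \<open>?p \<in> borel \<rightarrow>\<^sub>M borel\<close>, of "box l u"] by simp
  \<comment> \<open>\<open>measure_orthogonal_image\<close> compares real-valued measures of
    \<open>lmeasurable\<close> sets; finiteness allows the return to
    \<open>emeasure\<close>.\<close>
  have fin: "emeasure lborel ?A < \<infinity>"
    unfolding A by (simp add: emeasure_lborel_box_eq)
  have Al: "?A \<in> lmeasurable"
    using Ab fin by (simp add: fmeasurable_def)
  have Bb: "?p -` ((*) \<zeta> -` box l u) \<in> sets borel"
    using measurable_sets[of "\<lambda>x. \<zeta> * ?p x" borel borel "box l u"] by (simp add: vimage_def)
  have "emeasure (distr lborel borel ((*) \<zeta>)) (box l u) = emeasure lborel ((*) \<zeta> -` box l u)"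
    by (subst emeasure_distr) auto
  also have "\<dots> = emeasure lborel (?p -` ((*) \<zeta> -` box l u))"
    using measurable_sets[of "(*) \<zeta>" borel borel "box l u"]
    by (subst distr_lborel_vec2_complex[symmetric], subst emeasure_distr) auto
  also have "\<dots> = emeasure lebesgue (T ` ?A)"
    using Bb by (simp add: eq)
  also have "\<dots> = emeasure lebesgue ?A"
    using measure_orthogonal_image[OF T Al] measurable_orthogonal_image[OF T Al] Al
    by (simp add: emeasure_eq_measure2)
  also have "\<dots> = emeasure lborel (box l u)"
    using Ab by (simp add: A)
  finally show "emeasure (distr lborel borel ((*) \<zeta>)) (box l u) = ennreal (\<Prod>b\<in>Basis. (u - l) \<bullet> b)"
    using le by (simp add: emeasure_lborel_box_eq)
qed simp

section \<open>Integration over the unit disc: radial functions and orthogonality of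
  monomials\<close>

abbreviation disc :: "complex measure" where
  "disc \<equiv> lebesgue_on (ball 0 1)"

lemma finite_measure_disc: "finite_measure disc"
  by (rule finite_measureI)
     (use bounded_set_imp_lmeasurable[of "ball (0::complex) 1"] in
       \<open>auto simp: emeasure_restrict_space space_restrict_space emeasure_ball\<close>)

lemma measurable_disc: "f \<in> borel_measurable borel \<Longrightarrow> f \<in> borel_measurable disc"
  by (intro measurable_restrict_space1 measurable_completion) simp

lemma measurable_indicator_ball_scaleR [measurable]:
  fixes f :: "complex \<Rightarrow> 'b::euclidean_space"
  assumes "f \<in> borel_measurable borel"
  shows "(\<lambda>w. indicat_real (ball 0 1) w *\<^sub>R f w) \<in> borel_measurable borel"
  using assms by (intro borel_measurable_scaleR borel_measurable_indicator) auto

text \<open>Borel integrands have the same integral for \<open>lborel\<close> as for its completion,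
  so the image-measure identities for \<open>lborel\<close> become available on
  \<open>disc\<close>.\<close>

lemma integral_disc_borel:
  fixes f :: "complex \<Rightarrow> 'b::euclidean_space"
  assumes [measurable]: "f \<in> borel_measurable borel"
  shows "integral\<^sup>L disc f = (LINT w|lborel. indicator (ball 0 1) w *\<^sub>R f w)"
  by (simp add: integral_restrict_space integral_completion)

lemma integrable_disc_bounded:
  fixes f :: "complex \<Rightarrow> 'b::euclidean_space"
  assumes "f \<in> borel_measurable disc" and "\<And>w. cmod w < 1 \<Longrightarrow> norm (f w) \<le> B"
  shows "integrable disc f"
proof -
  interpret finite_measure disc by (rule finite_measure_disc)
  show ?thesis
    using assms by (intro integrable_const_bound[where B = B]) (auto simp: AE_restrict_space_iff)
qed

text \<open>Polar coordinates with t = |w|^2: the disc |w|^2 < t has area pi t for t in [0, 1], so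
  the squared modulus has constant density pi there. It suffices to compare the finite values on the
  half-lines \<open>{x<..}\<close>.\<close>

lemma distr_disc_cmod_power2:
  "distr (restrict_space lborel (ball 0 1)) borel (\<lambda>w::complex. (cmod w)\<^sup>2) =
   density lborel (\<lambda>t. ennreal (pi * indicator {0..1} t))"
proof (rule measure_eqI_lessThan)
  let ?M = "distr (restrict_space lborel (ball 0 1)) borel (\<lambda>w::complex. (cmod w)\<^sup>2)"
  have M: "emeasure ?M {x<..} = emeasure lborel {w::complex. cmod w < 1 \<and> x < (cmod w)\<^sup>2}" for x
    by (subst emeasure_distr)
       (auto simp: emeasure_restrict_space space_restrict_space intro!: measurable_restrict_space1 arg_cong[where f="emeasure lborel"])
  have ball: "emeasure lborel (ball (0::complex) r) = ennreal (pi * r\<^sup>2)" if "r \<ge> 0" for r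
    using that by (simp add: emeasure_ball unit_ball_vol_2)
  have cball: "emeasure lborel (cball (0::complex) r) = ennreal (pi * r\<^sup>2)" if "r \<ge> 0" for r
    using that by (simp add: emeasure_cball unit_ball_vol_2)
  \<comment> \<open>Clamping x to [0, 1] unites three cases: the full disc for x < 0, an annulus
    with inner radius \<open>sqrt x\<close>, and the empty set for x at least 1.\<close>
  have val: "emeasure ?M {x<..} = ennreal (pi * (1 - min 1 (max 0 x)))" for x
  proof -
    consider "x < 0" | "0 \<le> x" "x < 1" | "1 \<le> x" by linarith
    then show ?thesis
    proof cases
      case 1
      then have "{w::complex. cmod w < 1 \<and> x < (cmod w)\<^sup>2} = ball 0 1"
        by (auto intro: less_le_trans)
      with 1 show ?thesis using ball[of 1] by (simp add: M)
    next
      case 2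
      have eq: "{w::complex. cmod w < 1 \<and> x < (cmod w)\<^sup>2} = ball 0 1 - cball 0 (sqrt x)"
        using 2 by (auto simp: not_le real_less_rsqrt real_le_rsqrt) (metis norm_ge_zero power2_less_imp_less real_sqrt_pow2 not_le real_sqrt_less_iff real_sqrt_abs abs_norm_cancel)+
      have "cball 0 (sqrt x) \<subseteq> ball (0::complex) 1"
        using real_sqrt_less_iff[of x 1] 2 by (auto intro: le_less_trans simp del: real_sqrt_lt_1_iff)
      then have "emeasure ?M {x<..} = ennreal (pi * 1\<^sup>2) - ennreal (pi * (sqrt x)\<^sup>2)"
        unfolding M eq using 2 by (subst emeasure_Diff) (auto simp: ball cball)
      with 2 show ?thesis
        by (simp add: ennreal_minus algebra_simps)
    next
      case 3
      have False if "cmod w < 1" "x < (cmod w)\<^sup>2" for w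
        using that 3 power_le_one[of "cmod w" 2] by auto
      then have "{w::complex. cmod w < 1 \<and> x < (cmod w)\<^sup>2} = {}"
        by auto
      then show ?thesis unfolding M using 3 by (simp only: emeasure_empty) simp
    qed
  qed
  show "emeasure ?M {x<..} < \<infinity>" for x
    unfolding val by simp
  show "emeasure ?M {x<..} = emeasure (density lborel (\<lambda>t. ennreal (pi * indicator {0..1} t))) {x<..}" for x
  proof -
    have "emeasure (density lborel (\<lambda>t. ennreal (pi * indicator {0..1} t))) {x<..} =
      (\<integral>\<^sup>+t. ennreal pi * indicator ({0..1} \<inter> {x<..}) t \<partial>lborel)"
      by (subst emeasure_density) (auto intro!: nn_integral_cong split: split_indicator)
    also have "\<dots> = ennreal pi * emeasure lborel ({0..1} \<inter> {x<..})"
      by (rule nn_integral_cmult_indicator) auto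
    also have "{0..1} \<inter> {x<..} = (if x < 0 then {0..1} else {x<..1})"
      by auto
    also have "ennreal pi * emeasure lborel \<dots> = ennreal (pi * (1 - min 1 (max 0 x)))"
      by (cases "x \<le> 1") (auto simp: ennreal_mult[symmetric] max_def min_def)
    finally show ?thesis unfolding val by simp
  qed
qed auto

lemma integral_disc_radial:
  fixes f :: "real \<Rightarrow> real"
  assumes f: "f \<in> borel_measurable borel"
  shows "(LINT w|disc. f ((cmod w)\<^sup>2)) = pi * (LINT t|lborel. f t * indicator {0..1} t)"
proof -
  have "(LINT w|disc. f ((cmod w)\<^sup>2)) = (LINT w|restrict_space lborel (ball 0 1). f ((cmod w)\<^sup>2))"
    using f by (subst integral_disc_borel) (auto simp: integral_restrict_space)
  also have "\<dots> = integral\<^sup>L (distr (restrict_space lborel (ball 0 1)) borel (\<lambda>w::complex. (cmod w)\<^sup>2)) f"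
    using f by (intro integral_distr[symmetric]) (auto intro!: measurable_restrict_space1)
  also have "\<dots> = (LINT t|lborel. (pi * indicator {0..1} t) *\<^sub>R f t)"
    unfolding distr_disc_cmod_power2 using f by (intro integral_density) auto
  finally show ?thesis
    by (simp add: mult_ac)
qed

lemma integral_disc_rotation:
  fixes f :: "complex \<Rightarrow> complex"
  assumes f [measurable]: "f \<in> borel_measurable borel" and "cmod \<zeta> = 1"
  shows "(LINT w|disc. f (\<zeta> * w)) = integral\<^sup>L disc f"
proof -
  have "integral\<^sup>L disc f = (LINT w|distr lborel borel ((*) \<zeta>). indicator (ball 0 1) w *\<^sub>R f w)"
    using f assms by (simp add: integral_disc_borel distr_lborel_rotation)
  also have "\<dots> = (LINT w|lborel. indicator (ball 0 1) (\<zeta> * w) *\<^sub>R f (\<zeta> * w))"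
    by (intro integral_distr) auto
  also have "\<dots> = (LINT w|disc. f (\<zeta> * w))"
    using f assms by (subst integral_disc_borel)
      (auto intro!: Bochner_Integration.integral_cong simp: indicator_def norm_mult)
  finally show ?thesis ..
qed

text \<open>A suitable rotation preserves the disc and the radial factor but changes the sign of the
  integrand, so the integral equals its own negative.\<close>

lemma integral_disc_monomials_orthogonal:
  fixes g :: "real \<Rightarrow> real"
  assumes [measurable]: "g \<in> borel_measurable borel" and "m \<noteq> n"
  shows "(LINT w|disc. w ^ m * cnj (w ^ n) * of_real (g ((cmod w)\<^sup>2))) = 0"
proof -
  let ?f = "\<lambda>w. w ^ m * cnj (w ^ n) * complex_of_real (g ((cmod w)\<^sup>2))"
  let ?k = "int m - int n"
  \<comment> \<open>The angle is chosen so that (m - n) times it is pi, which makes the rotation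
    factor -1. The difference is taken in the integers because m < n is possible.\<close>
  define \<zeta> where "\<zeta> = cis (pi / ?k)"
  have [measurable]: "cnj \<in> borel_measurable borel"
    by (intro borel_measurable_continuous_onI continuous_intros)
  have meas: "?f \<in> borel_measurable borel"
    by measurable
  have z: "\<zeta> ^ m * cnj (\<zeta> ^ n) = -1"
  proof -
    have "\<zeta> ^ m * cnj (\<zeta> ^ n) = cis (m * (pi / ?k) - n * (pi / ?k))"
      by (simp only: \<zeta>_def Complex.DeMoivre cis_cnj cis_mult diff_conv_add_uminus)
    also have "m * (pi / ?k) - n * (pi / ?k) = pi"
      using \<open>m \<noteq> n\<close> by (simp add: left_diff_distrib[symmetric] flip: diff_divide_distrib)
    finally show ?thesis by simp
  qed
  have rot: "?f (\<zeta> * w) = - ?f w" for w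
  proof -
    have "?f (\<zeta> * w) = (\<zeta> ^ m * cnj (\<zeta> ^ n)) * ?f w"
      by (simp add: \<zeta>_def norm_mult power_mult_distrib mult_ac)
    then show ?thesis unfolding z by simp
  qed
  have "integral\<^sup>L disc ?f = (LINT w|disc. ?f (\<zeta> * w))"
    by (rule integral_disc_rotation[OF meas, symmetric]) (simp add: \<zeta>_def)
  also have "\<dots> = (LINT w|disc. - ?f w)"
    by (simp only: rot)
  finally show ?thesis by simp
qed

section \<open>Finite Parseval identities on the circle and on the disc\<close>

text \<open>Pythagoras for a family orthogonal with respect to the weight \<open>g\<close>, kept
  abstract to serve both the exponentials on the circle and the monomials on the disc. Writing |z|^2
  as z times its conjugate yields a double sum of which only the diagonal survives.\<close>

lemma has_bochner_integral_norm_sum_square: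
  fixes e :: "nat \<Rightarrow> 'a \<Rightarrow> complex" and c :: "nat \<Rightarrow> complex" and d :: "nat \<Rightarrow> real"
  assumes *: "\<And>m n. has_bochner_integral M (\<lambda>x. e m x * cnj (e n x) * of_real (g x)) (if m = n then of_real (d n) else 0)"
  shows "has_bochner_integral M (\<lambda>x. (cmod (\<Sum>n<N. c n * e n x))\<^sup>2 * g x) (\<Sum>n<N. (cmod (c n))\<^sup>2 * d n)"
proof -
  have eq: "complex_of_real ((cmod (\<Sum>n<N. c n * e n x))\<^sup>2 * g x) =
      (\<Sum>m<N. \<Sum>n<N. (c m * cnj (c n)) * (e m x * cnj (e n x) * of_real (g x)))" for x
    by (simp only: of_real_mult complex_norm_square cnj_sum complex_cnj_mult sum_product)
      (simp only: sum_distrib_left sum_distrib_right mult_ac)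
  have "has_bochner_integral M (\<lambda>x. complex_of_real ((cmod (\<Sum>n<N. c n * e n x))\<^sup>2 * g x))
      (\<Sum>m<N. \<Sum>n<N. (c m * cnj (c n)) * (if m = n then of_real (d n) else 0))"
    unfolding eq by (intro has_bochner_integral_sum has_bochner_integral_mult_right *)
  also have "(\<Sum>m<N. \<Sum>n<N. (c m * cnj (c n)) * (if m = n then of_real (d n) else 0)) =
      complex_of_real (\<Sum>n<N. (cmod (c n))\<^sup>2 * d n)"
    by (simp add: complex_norm_square if_distrib sum.delta cong: if_cong del: of_real_power)
  finally have "has_bochner_integral M (\<lambda>x. Re (complex_of_real ((cmod (\<Sum>n<N. c n * e n x))\<^sup>2 * g x)))
      (Re (complex_of_real (\<Sum>n<N. (cmod (c n))\<^sup>2 * d n)))"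
    by (rule has_bochner_integral_bounded_linear[OF bounded_linear_Re])
  then show ?thesis by (simp only: Re_complex_of_real)
qed

lemma has_bochner_integral_cis:
  assumes "k \<noteq> (0::int)"
  shows "has_bochner_integral lborel (\<lambda>\<theta>. indicator {0..2*pi} \<theta> *\<^sub>R cis (k * \<theta>)) 0"
proof -
  have "has_bochner_integral lborel (\<lambda>\<theta>. indicator {0..2*pi} \<theta> *\<^sub>R cis (k * \<theta>))
    (cis (k * (2*pi)) / (\<i> * k) - cis (k * (0::real)) / (\<i> * k))"
  proof (rule has_bochner_integral_FTC_Icc)
    show "((\<lambda>\<theta>. cis (k * \<theta>) / (\<i> * k)) has_vector_derivative cis (k * \<theta>)) (at \<theta> within {0..2*pi})" for \<theta> :: real
    proof -
      have "((\<lambda>z. exp (\<i> * k * z) / (\<i> * k)) has_field_derivative exp (\<i> * k * \<theta>)) (at (of_real \<theta>))"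
        using assms by (auto intro!: derivative_eq_intros)
      from has_vector_derivative_real_field[OF this] show ?thesis
        by (simp add: cis_conv_exp mult_ac)
    qed
  qed (use assms in \<open>auto intro!: continuous_intros\<close>)
  moreover have "cis (k * (2*pi)) = 1"
    using cis_multiple_2pi[of "of_int k"] by (simp add: mult_ac)
  ultimately show ?thesis by simp
qed

text \<open>The frequencies -(n + 2) are those of z^(-(n + 2)) on a circle about 0. The indicator of
  one period plays the role of the weight \<open>g\<close>.\<close>

lemma has_bochner_integral_trig_poly:
  "has_bochner_integral lborel
     (\<lambda>\<theta>. (cmod (\<Sum>n<N. c n * cis (- real (n + 2) * \<theta>)))\<^sup>2 * indicator {0..2*pi} \<theta>)
     (\<Sum>n<N. (cmod (c n))\<^sup>2 * (2 * pi))"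
proof (rule has_bochner_integral_norm_sum_square)
  fix m n
  \<comment> \<open>The two shifts by 2 cancel, leaving the integer frequency n - m.\<close>
  have eq: "cis (- real (m + 2) * \<theta>) * cnj (cis (- real (n + 2) * \<theta>)) * complex_of_real (indicator {0..2*pi} \<theta>)
     = indicator {0..2*pi} \<theta> *\<^sub>R cis ((int n - int m) * \<theta>)" for \<theta> :: real
    by (simp add: cis_cnj cis_mult scaleR_conv_of_real algebra_simps)
  show "has_bochner_integral lborel
      (\<lambda>\<theta>. cis (- real (m + 2) * \<theta>) * cnj (cis (- real (n + 2) * \<theta>)) * complex_of_real (indicator {0..2*pi} \<theta>))
      (if m = n then complex_of_real (2 * pi) else 0)"
  proof (cases "m = n")
    case True
    have "has_bochner_integral lborel (\<lambda>\<theta>. indicator {0..2*pi} \<theta> *\<^sub>R (1::complex)) (measure lborel {0..2*pi} *\<^sub>R 1)"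
      by (intro has_bochner_integral_indicator) auto
    then show ?thesis
      unfolding eq unfolding True by (simp add: scaleR_conv_of_real)
  next
    case False
    then show ?thesis
      unfolding eq using has_bochner_integral_cis[of "int n - int m"] by simp
  qed
qed

text \<open>With t = |w|^2 this is pi times the integral of t^n (s - t) over [0, 1]. For s = R^2 it
  is the squared norm of w^n in the weighted space on the disc.\<close>

lemma integral_disc_weighted_power:
  "(LINT w|disc. ((cmod w)\<^sup>2) ^ n * (s - (cmod w)\<^sup>2)) = pi * (s / (real n + 1) - 1 / (real n + 2))"
proof -
  have "has_bochner_integral lborel (\<lambda>t::real. (t ^ n * (s - t)) * indicator {0..1} t)
     ((s * 1 ^ (n + 1) / (real n + 1) - 1 ^ (n + 2) / (real n + 2)) - (s * 0 ^ (n + 1) / (real n + 1) - 0 ^ (n + 2) / (real n + 2)))"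
  proof (rule has_bochner_integral_FTC_Icc_real)
    fix t :: real
    show "((\<lambda>t. s * t ^ (n + 1) / (real n + 1) - t ^ (n + 2) / (real n + 2)) has_real_derivative t ^ n * (s - t)) (at t)"
      by (rule derivative_eq_intros refl | simp)+
        (use add_pos_nonneg[of 1 "real n"] add_pos_nonneg[of 2 "real n"] in \<open>simp add: divide_simps; simp add: algebra_simps\<close>)
  qed (auto intro!: continuous_intros)
  then show ?thesis
    by (subst integral_disc_radial[of "\<lambda>t. t ^ n * (s - t)"]) (auto simp: has_bochner_integral_integral_eq add.commute)
qed

text \<open>The source of the logarithm in the final bound: -ln (s - t) is a primitive of 1 / (s -
  t), and s > 1 excludes a singularity on [0, 1].\<close>

lemma integral_disc_inverse_weight:
  assumes "s > 1"
  shows "(LINT w|disc. 1 / (s - (cmod w)\<^sup>2)) = pi * ln (s / (s - 1))"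
proof -
  have "has_bochner_integral lborel (\<lambda>t::real. 1 / (s - t) * indicator {0..1} t) (- ln (s - 1) - (- ln (s - 0)))"
  proof (rule has_bochner_integral_FTC_Icc_nonneg)
    fix t :: real assume "t \<in> {0..1}"
    then show "((\<lambda>t. - ln (s - t)) has_real_derivative 1 / (s - t)) (at t)"
      using assms by (auto intro!: derivative_eq_intros)
  qed (use assms in \<open>auto intro!: continuous_intros\<close>)
  then show ?thesis
    using assms by (subst integral_disc_radial[of "\<lambda>t. 1 / (s - t)"])
      (auto simp: has_bochner_integral_integral_eq ln_div)
qed

lemma has_bochner_integral_disc_polynomial:
  fixes c :: "nat \<Rightarrow> complex" and s :: real
  shows "has_bochner_integral disc
    (\<lambda>w. (cmod (\<Sum>n<N. c n * w ^ n))\<^sup>2 * (s - (cmod w)\<^sup>2))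
    (\<Sum>n<N. (cmod (c n))\<^sup>2 * (pi * (s / (real n + 1) - 1 / (real n + 2))))"
proof (rule has_bochner_integral_norm_sum_square)
  fix m n
  let ?f = "\<lambda>w. w ^ m * cnj (w ^ n) * complex_of_real (s - (cmod w)\<^sup>2)"
  have "integrable disc ?f"
  proof (rule integrable_disc_bounded)
    show "?f \<in> borel_measurable disc"
      by (intro measurable_disc borel_measurable_continuous_onI continuous_intros)
    fix w :: complex assume "cmod w < 1"
    then have "cmod w ^ m \<le> 1" "cmod w ^ n \<le> 1" "(cmod w)\<^sup>2 \<le> 1"
      by (auto intro!: power_le_one)
    then have "\<bar>s - (cmod w)\<^sup>2\<bar> \<le> \<bar>s\<bar> + 1"
      using zero_le_power2[of "cmod w"] by linarith
    then have "cmod w ^ m * cmod w ^ n * \<bar>s - (cmod w)\<^sup>2\<bar> \<le> 1 * 1 * (\<bar>s\<bar> + 1)"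
      using \<open>cmod w ^ m \<le> 1\<close> \<open>cmod w ^ n \<le> 1\<close> by (intro mult_mono) auto
    then show "norm (?f w) \<le> \<bar>s\<bar> + 1"
      by (simp add: norm_mult norm_power del: of_real_diff of_real_power)
  qed
  moreover have "integral\<^sup>L disc ?f = (if m = n then complex_of_real (pi * (s / (real n + 1) - 1 / (real n + 2))) else 0)"
  proof (cases "m = n")
    case True
    \<comment> \<open>On the diagonal the product of w^n and its conjugate is |w|^(2n), so the
      integral reduces to the real radial one.\<close>
    have "?f w = complex_of_real (((cmod w)\<^sup>2) ^ n * (s - (cmod w)\<^sup>2))" for w
      using True by (simp only: of_real_mult of_real_power[of _ n] complex_norm_square complex_cnj_power power_mult_distrib)
    then have "integral\<^sup>L disc ?f = complex_of_real (LINT w|disc. ((cmod w)\<^sup>2) ^ n * (s - (cmod w)\<^sup>2))"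
      by (simp only: integral_complex_of_real)
    then show ?thesis
      using True by (simp only: integral_disc_weighted_power refl if_True)
  next
    case False
    then show ?thesis
      using integral_disc_monomials_orthogonal[of "\<lambda>t. s - t" m n] by simp
  qed
  ultimately show "has_bochner_integral disc ?f
      (if m = n then complex_of_real (pi * (s / (real n + 1) - 1 / (real n + 2))) else 0)"
    by (simp only: has_bochner_integral_iff)
qed

lemma integral_disc_const: "(LINT w|disc. c) = pi * (c::real)"
proof -
  have "measure lborel (ball (0::complex) 1) = pi"
    by (simp add: content_ball unit_ball_vol_2)
  then show ?thesis
    by (simp add: measure_restrict_space space_restrict_space)
qed

section \<open>The Beurling transform outside the disc and its kernel expansion\<close>

text \<open>A point z with |z| > 1 has distance at least |z| - 1 from the disc. A truncation at a
  smaller radius removes nothing from the support of \<open>\<mu>\<close>, so the truncated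
  integrals are constant near 0 and the principal value is an ordinary integral.\<close>

lemma beurling_outside_disc:
  assumes supp: "\<And>w. cmod (\<mu> w) \<le> indicator (ball 0 1) w" and z: "1 < cmod z"
  shows "beurling \<mu> z = - (1 / complex_of_real pi) * (LINT w|disc. \<mu> w / (z - w)\<^sup>2)"
proof -
  let ?v = "- (1 / complex_of_real pi) * (LINT w|disc. \<mu> w / (z - w)\<^sup>2)"
  have trunc: "beurling_trunc \<mu> \<epsilon> z = ?v" if "0 < \<epsilon>" "\<epsilon> < cmod z - 1" for \<epsilon>
  proof -
    have eq: "indicat_real {w. \<epsilon> < cmod (z - w)} w *\<^sub>R (\<mu> w / (z - w)\<^sup>2) =
        indicat_real (ball 0 1) w *\<^sub>R (\<mu> w / (z - w)\<^sup>2)" for w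
    proof (cases "cmod w < 1")
      case True
      then have "\<epsilon> < cmod (z - w)"
        using that norm_triangle_ineq2[of z w] by linarith
      with True show ?thesis by simp
    next
      case False
      then have "\<mu> w = 0"
        using supp[of w] by simp
      then show ?thesis by simp
    qed
    show ?thesis
      unfolding beurling_trunc_def set_lebesgue_integral_def eq
      by (subst integral_restrict_space) auto
  qed
  have "eventually (\<lambda>\<epsilon>. beurling_trunc \<mu> \<epsilon> z = ?v) (at_right 0)"
    using z by (intro eventually_at_rightI[of 0 "cmod z - 1"]) (auto simp only: trunc diff_gt_0_iff_gt greaterThanLessThan_iff)
  then have "((\<lambda>\<epsilon>. beurling_trunc \<mu> \<epsilon> z) \<longlongrightarrow> ?v) (at_right 0)"
    by (rule tendsto_eventually)
  then show ?thesis
    unfolding beurling_def by (intro tendsto_Lim) auto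
qed

definition moment :: "(complex \<Rightarrow> complex) \<Rightarrow> nat \<Rightarrow> complex" where
  "moment \<mu> n = (LINT w|disc. \<mu> w * w ^ n)"

lemma norm_monomial_le_1: "cmod w < 1 \<Longrightarrow> cmod (w ^ n) \<le> 1"
  by (auto simp: norm_power intro!: power_le_one)

text \<open>The differentiated geometric series in w / z, divided by z^2; this division produces the
  exponent n + 2.\<close>

lemma cauchy_square_sums:
  fixes w z :: complex
  assumes "cmod w < cmod z"
  shows "(\<lambda>n. of_nat (n + 1) * w ^ n / z ^ (n + 2)) sums (1 / (z - w)\<^sup>2)"
proof -
  have z: "z \<noteq> 0" using assms by auto
  have "(\<lambda>n. of_nat (Suc n) * (w / z) ^ n / z\<^sup>2) sums (1 / (1 - w / z)\<^sup>2 / z\<^sup>2)"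
    using assms z by (intro sums_divide geometric_deriv_sums) (simp add: norm_divide)
  moreover have "1 / (1 - w / z)\<^sup>2 / z\<^sup>2 = 1 / (z - w)\<^sup>2"
  proof -
    have "(1 - w / z)\<^sup>2 * z\<^sup>2 = (z - w)\<^sup>2"
      using z by (simp flip: power_mult_distrib add: algebra_simps)
    then show ?thesis by simp
  qed
  ultimately show ?thesis
    by (simp add: power_divide power_add power2_eq_square mult_ac)
qed

text \<open>The case w = 1, z = R of the kernel series. It is the majorant both for termwise
  integration over the disc and for the partial sums on the circle.\<close>

lemma summable_weights:
  assumes "1 < (R::real)"
  shows "summable (\<lambda>n. real (n + 1) / R ^ (n + 2))"
proof -
  have "summable (\<lambda>n. real (Suc n) * (1 / R) ^ n / R\<^sup>2)"
    using assms by (intro summable_divide sums_summable[OF geometric_deriv_sums]) simp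
  then show ?thesis
    by (simp add: power_divide power_add power2_eq_square mult_ac)
qed

text \<open>Compares the squared expansion weight with the squared norm of w^n divided by pi. With x
  = R^2 and denominators cleared, it reads (n + 1) / (n + 2) times ((n + 2) x - (n + 1)) is at most
  x^(n + 2).\<close>

lemma weight_inequality:
  assumes "1 < (R::real)"
  shows "(real (n + 1) / R ^ (n + 2))\<^sup>2 * (R\<^sup>2 / (real n + 1) - 1 / (real n + 2)) \<le> 1"
proof -
  define x where "x = R\<^sup>2"
  have x: "x > 1" using assms by (simp add: x_def)
  have R: "(R ^ (n + 2))\<^sup>2 = x ^ (n + 2)"
    by (simp only: x_def power_mult[symmetric] mult.commute)
  \<comment> \<open>The aim \<open>A\<close> says that x^(n + 2) lies above its tangent at x = 1.
    Bernoulli for the exponent n + 1, multiplied by x, gives a quadratic lower bound, which exceeds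
    the tangent by (n + 1) (x - 1)^2.\<close>
  have "x * (1 + (real n + 1) * (x - 1)) \<le> x * x ^ (n + 1)"
    using Bernoulli_inequality[of "x - 1" "n + 1"] x by (intro mult_left_mono) (auto simp: add.commute)
  moreover have "(real n + 2) * x - (real n + 1) \<le> x * (1 + (real n + 1) * (x - 1))"
  proof -
    have "x * (1 + (real n + 1) * (x - 1)) - ((real n + 2) * x - (real n + 1)) = (real n + 1) * (x - 1)\<^sup>2"
      by (simp add: algebra_simps power2_eq_square)
    moreover have "(real n + 1) * (x - 1)\<^sup>2 \<ge> 0" by simp
    ultimately show ?thesis by linarith
  qed
  ultimately have A: "(real n + 2) * x - (real n + 1) \<le> x ^ (n + 2)"
    by simp
  have "(real n + 1)\<^sup>2 * (x / (real n + 1) - 1 / (real n + 2)) = (real n + 1) / (real n + 2) * ((real n + 2) * x - (real n + 1))"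
    by (simp add: divide_simps power2_eq_square)
  \<comment> \<open>The factor (n + 1) / (n + 2) is bounded by 1; multiplying the two inequalities
    requires the tangent value to be nonnegative, which x > 1 ensures.\<close>
  also have "\<dots> \<le> 1 * x ^ (n + 2)"
  proof (rule mult_mono[OF _ A])
    have "(real n + 2) * x - (real n + 1) = (real n + 2) * (x - 1) + 1"
      by (simp add: algebra_simps)
    also have "\<dots> \<ge> 0" using x by simp
    finally show "0 \<le> (real n + 2) * x - (real n + 1)" .
  qed (simp_all add: x_def)
  finally have B: "(real n + 1)\<^sup>2 * (x / (real n + 1) - 1 / (real n + 2)) \<le> x ^ (n + 2)"
    by simp
  have "(real (n + 1) / R ^ (n + 2))\<^sup>2 * (R\<^sup>2 / (real n + 1) - 1 / (real n + 2)) =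
      (real n + 1)\<^sup>2 * (x / (real n + 1) - 1 / (real n + 2)) / x ^ (n + 2)"
    by (simp only: power_divide R x_def[symmetric] of_nat_add of_nat_1 times_divide_eq_left)
  also have "\<dots> \<le> 1"
    using B x by (subst divide_le_eq_1_pos) auto
  finally show ?thesis .
qed

section \<open>Moments of a density bounded by 1 on the disc\<close>

context
  fixes \<mu> :: "complex \<Rightarrow> complex"
  assumes meas: "\<mu> \<in> borel_measurable lebesgue"
    and bound: "\<And>w. cmod (\<mu> w) \<le> indicator (ball 0 1) w"
begin

lemma norm_mu_le_1: "cmod (\<mu> w) \<le> 1"
  using bound[of w] by (cases "cmod w < 1") auto

lemma measurable_mult_disc:
  assumes "f \<in> borel_measurable borel"
  shows "(\<lambda>w. \<mu> w * f w) \<in> borel_measurable disc"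
  using meas by (intro borel_measurable_times measurable_disc assms measurable_restrict_space1)

lemma integrable_mult_disc:
  assumes "f \<in> borel_measurable borel" and "\<And>w. cmod w < 1 \<Longrightarrow> cmod (f w) \<le> B"
  shows "integrable disc (\<lambda>w. \<mu> w * f w)"
  using assms mult_mono[OF norm_mu_le_1 assms(2)]
  by (intro integrable_disc_bounded[where B = B] measurable_mult_disc) (auto simp: norm_mult)

text \<open>The pairing of L^1 with L^\<infinity>, with |mu| at most 1; the bound \<open>B\<close>
  secures integrability.\<close>

lemma norm_integral_mult_disc_le:
  assumes [measurable]: "f \<in> borel_measurable borel" and B: "\<And>w. cmod w < 1 \<Longrightarrow> cmod (f w) \<le> B"
  shows "cmod (LINT w|disc. \<mu> w * f w) \<le> (LINT w|disc. cmod (f w))"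
proof (rule order_trans[OF integral_norm_bound integral_mono])
  show "integrable disc (\<lambda>w. cmod (\<mu> w * f w))"
    by (intro integrable_norm integrable_mult_disc[OF assms])
  show "integrable disc (\<lambda>w. cmod (f w))"
    using B by (intro integrable_disc_bounded[where B = B] measurable_disc) auto
  show "cmod (\<mu> w * f w) \<le> cmod (f w)" for w
    using mult_right_mono[OF norm_mu_le_1 norm_ge_zero[of "f w"]] by (simp add: norm_mult)
qed

lemma integrable_moment: "integrable disc (\<lambda>w. \<mu> w * w ^ n)"
  by (rule integrable_mult_disc[OF _ norm_monomial_le_1]) auto

lemma norm_moment_le: "cmod (moment \<mu> n) \<le> pi"
proof -
  have "cmod (moment \<mu> n) \<le> (LINT w|disc. cmod (w ^ n))"
    unfolding moment_def by (rule norm_integral_mult_disc_le[OF _ norm_monomial_le_1]) auto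
  also have "\<dots> \<le> (LINT w::complex|disc. 1)"
    by (intro integral_mono integrable_disc_bounded[where B = 1] measurable_disc)
       (auto simp: space_restrict_space norm_power power_le_one)
  finally show ?thesis by (simp only: integral_disc_const mult_1_right)
qed

text \<open>Expand the kernel by \<open>cauchy_square_sums\<close> and integrate term by term. The
  exchange is justified because the L^1 norms of the terms are at most pi (n + 1) / |z|^(n + 2),
  which is summable.\<close>

lemma moment_sums:
  assumes "1 < cmod z"
  shows "(\<lambda>n. of_nat (n + 1) * moment \<mu> n / z ^ (n + 2)) sums (LINT w|disc. \<mu> w / (z - w)\<^sup>2)"
proof -
  define f where "f = (\<lambda>n w. (of_nat (n + 1) / z ^ (n + 2)) * (\<mu> w * w ^ n))"
  have f_le: "cmod (f n w) \<le> real (n + 1) / cmod z ^ (n + 2)" if "cmod w < 1" for n w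
  proof -
    have "cmod (\<mu> w * w ^ n) \<le> 1 * 1"
      unfolding norm_mult using norm_mu_le_1 norm_monomial_le_1[OF that] by (intro mult_mono) auto
    then have "(real (n + 1) / cmod z ^ (n + 2)) * cmod (\<mu> w * w ^ n) \<le> (real (n + 1) / cmod z ^ (n + 2)) * 1"
      by (intro mult_left_mono) auto
    moreover have "cmod (f n w) = (real (n + 1) / cmod z ^ (n + 2)) * cmod (\<mu> w * w ^ n)"
      by (simp only: f_def norm_mult norm_divide norm_power norm_of_nat)
    ultimately show ?thesis by simp
  qed
  have int: "integrable disc (f n)" for n
    unfolding f_def by (intro integrable_mult_right integrable_moment)
  have "(\<lambda>n. integral\<^sup>L disc (f n)) sums (LINT w|disc. (\<Sum>n. f n w))"
  proof (rule sums_integral[OF int])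
    have "summable (\<lambda>n. cmod (f n w))" if "cmod w < 1" for w
      using summable_weights[OF assms] by (rule summable_comparison_test') (use f_le[OF that] in auto)
    then show "AE w in disc. summable (\<lambda>n. cmod (f n w))"
      by (auto intro!: AE_I2 simp: space_restrict_space)
    have "(LINT w|disc. cmod (f n w)) \<le> pi * (real (n + 1) / cmod z ^ (n + 2))" for n
    proof -
      have "(LINT w|disc. cmod (f n w)) \<le> (LINT w::complex|disc. real (n + 1) / cmod z ^ (n + 2))"
        using f_le by (intro integral_mono integrable_norm int integrable_disc_bounded[where B = "real (n + 1) / cmod z ^ (n + 2)"] measurable_disc)
          (auto simp: space_restrict_space)
      then show ?thesis by (simp only: integral_disc_const)
    qed
    then show "summable (\<lambda>n. LINT w|disc. cmod (f n w))"
      by (intro summable_comparison_test'[OF summable_mult[OF summable_weights[OF assms], of pi]]) auto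
  qed
  also have "(\<lambda>n. integral\<^sup>L disc (f n)) = (\<lambda>n. of_nat (n + 1) * moment \<mu> n / z ^ (n + 2))"
  proof
    fix n
    have "integral\<^sup>L disc (f n) = of_nat (n + 1) / z ^ (n + 2) * moment \<mu> n"
      unfolding f_def moment_def by (rule integral_mult_right_zero)
    then show "integral\<^sup>L disc (f n) = of_nat (n + 1) * moment \<mu> n / z ^ (n + 2)"
      by (simp only: times_divide_eq_left)
  qed
  also have "(LINT w|disc. (\<Sum>n. f n w)) = (LINT w|disc. \<mu> w / (z - w)\<^sup>2)"
  proof (rule Bochner_Integration.integral_cong[OF refl])
    fix w assume "w \<in> space disc"
    then have "cmod w < cmod z" using assms by (simp add: space_restrict_space)
    from sums_mult[OF cauchy_square_sums[OF this], of "\<mu> w"]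
    have "(\<lambda>n. f n w) sums (\<mu> w / (z - w)\<^sup>2)"
      by (simp add: f_def mult_ac)
    then show "(\<Sum>n. f n w) = \<mu> w / (z - w)\<^sup>2"
      by (rule sums_unique[symmetric])
  qed
  finally show ?thesis .
qed

section \<open>The bound for the sum of squared coefficients\<close>

text \<open>Partial sums keep \<open>h\<close> a polynomial, bounded on the disc; the bound is
  uniform in \<open>N\<close> and hence survives the limit.\<close>

lemma sum_moments_le:
  assumes R: "1 < (R::real)"
  defines "a \<equiv> \<lambda>n. - (1 / complex_of_real pi) * (of_nat (n + 1) * moment \<mu> n / of_real R ^ (n + 2))"
  shows "(\<Sum>n<N. (cmod (a n))\<^sup>2) \<le> ln (R\<^sup>2 / (R\<^sup>2 - 1))"
proof -
  let ?X = "\<Sum>n<N. (cmod (a n))\<^sup>2"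
  define r where "r = (\<lambda>n. real (n + 1) / R ^ (n + 2))"
  \<comment> \<open>Since a_n is -(1/pi) r_n times the n-th moment, this choice turns conj(a_n) a_n
    into -(1/pi) c_n times that moment. The sum then becomes a pairing of \<open>\<mu>\<close> with
    \<open>h\<close>.\<close>
  define c where "c = (\<lambda>n. cnj (a n) * of_real (r n))"
  define h where "h = (\<lambda>w. \<Sum>n<N. c n * w ^ n)"
  have R2: "R\<^sup>2 > 1" using R by simp
  have h_meas: "h \<in> borel_measurable borel"
    unfolding h_def by (intro borel_measurable_continuous_onI continuous_intros)
  note [measurable] = h_meas
  have poly: "has_bochner_integral disc (\<lambda>w. (cmod (h w))\<^sup>2 * (R\<^sup>2 - (cmod w)\<^sup>2))
      (\<Sum>n<N. (cmod (c n))\<^sup>2 * (pi * (R\<^sup>2 / (real n + 1) - 1 / (real n + 2))))"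
    unfolding h_def by (rule has_bochner_integral_disc_polynomial)
  \<comment> \<open>The weight stays above the positive number R^2 - 1, so its reciprocal is bounded
    and integrable on the disc.\<close>
  have weight: "R\<^sup>2 - (cmod w)\<^sup>2 \<ge> R\<^sup>2 - 1" if "cmod w < 1" for w :: complex
    using that by (simp add: power_le_one)
  have inv: "integrable disc (\<lambda>w. 1 / (R\<^sup>2 - (cmod w)\<^sup>2))"
  proof (rule integrable_disc_bounded[where B = "1 / (R\<^sup>2 - 1)"])
    fix w :: complex assume "cmod w < 1"
    with weight[OF this] R2 show "norm (1 / (R\<^sup>2 - (cmod w)\<^sup>2)) \<le> 1 / (R\<^sup>2 - 1)"
      by (auto simp: abs_if intro!: frac_le)
  qed (intro measurable_disc, measurable)
  have h_bound: "cmod (h w) \<le> (\<Sum>n<N. cmod (c n))" if "cmod w < 1" for w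
    unfolding h_def
  proof (rule sum_norm_le)
    fix n
    show "cmod (c n * w ^ n) \<le> cmod (c n)"
      unfolding norm_mult using norm_monomial_le_1[OF that] by (intro mult_left_le) auto
  qed
  have "complex_of_real ?X = (\<Sum>n<N. cnj (a n) * a n)"
    by (simp only: of_real_sum complex_norm_square mult.commute)
  also have "\<dots> = - (1 / complex_of_real pi) * (\<Sum>n<N. c n * moment \<mu> n)"
  proof -
    have "a n = - (1 / complex_of_real pi) * (of_real (r n) * moment \<mu> n)" for n
      by (simp add: a_def r_def)
    then show ?thesis
      by (simp add: sum_distrib_left c_def mult_ac)
  qed
  also have "(\<Sum>n<N. c n * moment \<mu> n) = (\<Sum>n<N. LINT w|disc. c n * (\<mu> w * w ^ n))"
    by (simp only: moment_def integral_mult_right_zero)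
  also have "\<dots> = (LINT w|disc. (\<Sum>n<N. c n * (\<mu> w * w ^ n)))"
    by (intro Bochner_Integration.integral_sum[symmetric] integrable_mult_right integrable_moment)
  also have "\<dots> = (LINT w|disc. \<mu> w * h w)"
    by (simp only: h_def sum_distrib_left mult_ac)
  finally have "cmod (complex_of_real ?X) = cmod (- (1 / complex_of_real pi) * (LINT w|disc. \<mu> w * h w))"
    by simp
  \<comment> \<open>\<open>?X\<close> is nonnegative, so passing to moduli removes the sign and
    leaves only the factor 1/pi.\<close>
  then have "pi * ?X = cmod (LINT w|disc. \<mu> w * h w)"
    by (simp add: norm_mult norm_divide sum_nonneg del: of_real_sum)
  also have "\<dots> \<le> (LINT w|disc. cmod (h w))"
    by (rule norm_integral_mult_disc_le[OF h_meas h_bound])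
  also have "(LINT w|disc. cmod (h w)) \<le> (LINT w|disc. ((cmod (h w))\<^sup>2 * (R\<^sup>2 - (cmod w)\<^sup>2) + 1 / (R\<^sup>2 - (cmod w)\<^sup>2)) / 2)"
  proof (rule integral_mono)
    show "integrable disc (\<lambda>w. cmod (h w))"
      using h_bound by (intro integrable_disc_bounded measurable_disc) auto
    show "integrable disc (\<lambda>w. ((cmod (h w))\<^sup>2 * (R\<^sup>2 - (cmod w)\<^sup>2) + 1 / (R\<^sup>2 - (cmod w)\<^sup>2)) / 2)"
      using poly inv by (auto simp: has_bochner_integral_iff)
    fix w assume "w \<in> space disc"
    then have "cmod w < 1" by (simp add: space_restrict_space)
    from weight[OF this] R2 have t: "R\<^sup>2 - (cmod w)\<^sup>2 > 0" by linarith
    \<comment> \<open>The square expands to y^2 t - 2 y + 1 / t, which is the AM-GM inequality for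
      y^2 t and 1 / t.\<close>
    have "0 \<le> (y * t - 1)\<^sup>2 / t" if "t > 0" for y t :: real
      using that by simp
    then have "y \<le> (y\<^sup>2 * t + 1 / t) / 2" if "t > 0" for y t :: real
      using that by (simp add: power2_eq_square field_simps)
    from this[OF t] show "cmod (h w) \<le> ((cmod (h w))\<^sup>2 * (R\<^sup>2 - (cmod w)\<^sup>2) + 1 / (R\<^sup>2 - (cmod w)\<^sup>2)) / 2" .
  qed
  also have "\<dots> = ((\<Sum>n<N. (cmod (c n))\<^sup>2 * (pi * (R\<^sup>2 / (real n + 1) - 1 / (real n + 2)))) + pi * ln (R\<^sup>2 / (R\<^sup>2 - 1))) / 2"
    using poly inv integral_disc_inverse_weight[OF R2] by (simp add: has_bochner_integral_iff)
  finally have "2 * (pi * ?X) \<le> (\<Sum>n<N. (cmod (c n))\<^sup>2 * (pi * (R\<^sup>2 / (real n + 1) - 1 / (real n + 2))))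
      + pi * ln (R\<^sup>2 / (R\<^sup>2 - 1))"
    by simp
  \<comment> \<open>Termwise |c_n|^2 = |a_n|^2 r_n^2, and \<open>weight_inequality\<close> bounds
    r_n^2 times the squared norm of w^n by pi.\<close>
  moreover have "(\<Sum>n<N. (cmod (c n))\<^sup>2 * (pi * (R\<^sup>2 / (real n + 1) - 1 / (real n + 2)))) \<le> pi * ?X"
    unfolding sum_distrib_left
  proof (rule sum_mono)
    fix n
    have "(cmod (c n))\<^sup>2 * (pi * (R\<^sup>2 / (real n + 1) - 1 / (real n + 2))) =
      pi * (cmod (a n))\<^sup>2 * ((r n)\<^sup>2 * (R\<^sup>2 / (real n + 1) - 1 / (real n + 2)))"
      by (simp add: c_def norm_mult power_mult_distrib)
    also have "\<dots> \<le> pi * (cmod (a n))\<^sup>2 * 1"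
      unfolding r_def by (intro mult_left_mono weight_inequality R) auto
    finally show "(cmod (c n))\<^sup>2 * (pi * (R\<^sup>2 / (real n + 1) - 1 / (real n + 2))) \<le> pi * (cmod (a n))\<^sup>2"
      by simp
  qed
  \<comment> \<open>One of the two copies of pi X on the left absorbs the polynomial term on the
    right.\<close>
  ultimately have "pi * ?X \<le> pi * ln (R\<^sup>2 / (R\<^sup>2 - 1))"
    by linarith
  then show ?thesis by simp
qed

section \<open>Mean square of the Beurling transform on a circle\<close>

text \<open>On the circle the moment expansion is a Fourier series. Orthogonality evaluates the mean
  square of each partial sum \<open>P N\<close>, and since all of them are bounded by the constant
  \<open>K\<close>, dominated convergence carries the uniform bound to the limit.\<close>

lemma circle_mean_beurling_le:
  assumes R: "1 < (R::real)"
  shows "(1 / (2 * pi)) * (LBINT \<theta>=0..2*pi. (cmod (beurling \<mu> (complex_of_real R * cis \<theta>)))\<^sup>2)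
    \<le> ln (R\<^sup>2 / (R\<^sup>2 - 1))"
proof -
  define a where "a = (\<lambda>n. - (1 / complex_of_real pi) * (of_nat (n + 1) * moment \<mu> n / of_real R ^ (n + 2)))"
  define S where "S = (\<lambda>\<theta>. beurling \<mu> (of_real R * cis \<theta>))"
  define P where "P = (\<lambda>N \<theta>. \<Sum>n<N. a n * cis (- real (n + 2) * \<theta>))"
  define K where "K = (\<Sum>n. real (n + 1) / R ^ (n + 2))"
  have P_lim: "(\<lambda>N. P N \<theta>) \<longlonglongrightarrow> S \<theta>" for \<theta>
  proof -
    let ?z = "of_real R * cis \<theta>"
    have z: "1 < cmod ?z" using R by (simp add: norm_mult)
    have "- (1 / complex_of_real pi) * (of_nat (n + 1) * moment \<mu> n / ?z ^ (n + 2)) = a n * cis (- real (n + 2) * \<theta>)" for n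
    proof -
      have eq: "1 / cis \<theta> ^ (n + 2) = cis (- real (n + 2) * \<theta>)"
        by (simp only: Complex.DeMoivre) (simp add: algebra_simps flip: inverse_eq_divide)
      show ?thesis
        unfolding a_def power_mult_distrib eq[symmetric]
        by (simp only: times_divide_eq_right divide_divide_eq_left mult_1_right)
    qed
    with sums_mult[OF moment_sums[OF z], of "- (1 / complex_of_real pi)"]
    have "(\<lambda>n. a n * cis (- real (n + 2) * \<theta>)) sums S \<theta>"
      by (simp only: S_def beurling_outside_disc[OF bound z])
    then show ?thesis
      by (simp only: sums_def P_def)
  qed
  \<comment> \<open>The area bound pi for the moments cancels the factor 1/pi.\<close>
  have a_le: "cmod (a n) \<le> real (n + 1) / R ^ (n + 2)" for n
  proof -
    have "cmod (a n) = (1 / pi) * (real (n + 1) * cmod (moment \<mu> n) / R ^ (n + 2))"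
      unfolding a_def using R by (simp only: norm_mult norm_divide norm_power norm_of_nat norm_of_real norm_minus_cancel) simp
    also have "\<dots> \<le> (1 / pi) * (real (n + 1) * pi / R ^ (n + 2))"
      using R norm_moment_le by (intro mult_left_mono divide_right_mono) auto
    finally show ?thesis by simp
  qed
  have P_le: "cmod (P N \<theta>) \<le> K" for N \<theta>
  proof -
    have "cmod (P N \<theta>) \<le> (\<Sum>n<N. real (n + 1) / R ^ (n + 2))"
      unfolding P_def by (intro sum_norm_le) (use a_le in \<open>simp add: norm_mult\<close>)
    also have "\<dots> \<le> K"
      unfolding K_def using R by (intro sum_le_suminf summable_weights) auto
    finally show ?thesis .
  qed
  have [measurable]: "P N \<in> borel_measurable borel" for N
    unfolding P_def by (intro borel_measurable_continuous_onI continuous_intros)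
  \<comment> \<open>Measurability comes from the pointwise limit of continuous partial sums.\<close>
  have [measurable]: "S \<in> borel_measurable borel"
    by (rule borel_measurable_LIMSEQ_metric[OF _ P_lim]) measurable
  have "(\<lambda>N. LBINT \<theta>. (cmod (P N \<theta>))\<^sup>2 * indicator {0..2*pi} \<theta>)
      \<longlonglongrightarrow> (LBINT \<theta>. (cmod (S \<theta>))\<^sup>2 * indicator {0..2*pi} \<theta>)"
  proof (rule integral_dominated_convergence)
    show "integrable lborel (\<lambda>\<theta>. K\<^sup>2 * indicator {0..2*pi} \<theta>)"
      by (intro integrable_mult_right) simp
    show "AE \<theta> in lborel. (\<lambda>N. (cmod (P N \<theta>))\<^sup>2 * indicator {0..2*pi} \<theta>) \<longlonglongrightarrow> (cmod (S \<theta>))\<^sup>2 * indicator {0..2*pi} \<theta>"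
      by (intro AE_I2 tendsto_intros P_lim)
    show "AE \<theta> in lborel. norm ((cmod (P N \<theta>))\<^sup>2 * indicator {0..2*pi} \<theta>) \<le> K\<^sup>2 * indicator {0..2*pi} \<theta>" for N
      using P_le by (intro AE_I2) (auto simp: power_mono split: split_indicator)
  qed measurable
  moreover have "(LBINT \<theta>. (cmod (P N \<theta>))\<^sup>2 * indicator {0..2*pi} \<theta>) \<le> 2 * pi * ln (R\<^sup>2 / (R\<^sup>2 - 1))" for N
  proof -
    have "(LBINT \<theta>. (cmod (P N \<theta>))\<^sup>2 * indicator {0..2*pi} \<theta>) = 2 * pi * (\<Sum>n<N. (cmod (a n))\<^sup>2)"
      unfolding P_def by (subst has_bochner_integral_integral_eq[OF has_bochner_integral_trig_poly])
        (simp add: sum_distrib_left mult_ac)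
    also have "\<dots> \<le> 2 * pi * ln (R\<^sup>2 / (R\<^sup>2 - 1))"
      unfolding a_def by (intro mult_left_mono sum_moments_le R) auto
    finally show ?thesis .
  qed
  ultimately have "(LBINT \<theta>. (cmod (S \<theta>))\<^sup>2 * indicator {0..2*pi} \<theta>) \<le> 2 * pi * ln (R\<^sup>2 / (R\<^sup>2 - 1))"
    by (intro LIMSEQ_le_const2) auto
  moreover have "(LBINT \<theta>=0..2*pi. (cmod (S \<theta>))\<^sup>2) = (LBINT \<theta>. (cmod (S \<theta>))\<^sup>2 * indicator {0..2*pi} \<theta>)"
    using interval_integral_Icc[of 0 "2 * pi" "\<lambda>\<theta>. (cmod (S \<theta>))\<^sup>2"]
    by (simp add: set_lebesgue_integral_def zero_ereal_def mult.commute)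
  ultimately show ?thesis
    by (simp add: S_def field_simps)
qed

end

section \<open>From ln (R^2 / (R^2 - 1)) to a bound by ln (1 / (R - 1))\<close>

theorem theorem4p1:
  shows "\<forall>\<delta>::real. 0 < \<delta> \<and> \<delta> < 1 \<longrightarrow>
    (\<exists>c::real. \<forall>\<mu>::complex \<Rightarrow> complex.
       \<mu> \<in> borel_measurable lebesgue \<and>
       (\<forall>w. cmod (\<mu> w) \<le> indicator (ball 0 1) w) \<longrightarrow>
       (\<forall>R::real. 1 < R \<and> R < 2 \<longrightarrow>
          (1 / (2 * pi)) * (LBINT \<theta>=0..2*pi. (cmod (beurling \<mu> (complex_of_real R * cis \<theta>)))^2)
            \<le> (1 + \<delta>) * ln (1 / (R - 1)) + c))"
\<comment> \<open>The witness \<open>ln 2\<close> arises from R^2 / (R^2 - 1) = R^2 / (R + 1) times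
  1 / (R - 1), where the first factor is at most 2 for 1 < R < 2.\<close>
proof (intro allI impI exI[of _ "ln 2"])
  fix \<delta> R :: real and \<mu> :: "complex \<Rightarrow> complex"
  assume \<delta>: "0 < \<delta> \<and> \<delta> < 1" and R: "1 < R \<and> R < 2"
    and \<mu>: "\<mu> \<in> borel_measurable lebesgue \<and> (\<forall>w. cmod (\<mu> w) \<le> indicator (ball 0 1) w)"
  have "(1 / (2 * pi)) * (LBINT \<theta>=0..2*pi. (cmod (beurling \<mu> (complex_of_real R * cis \<theta>)))\<^sup>2)
      \<le> ln (R\<^sup>2 / (R\<^sup>2 - 1))"
    using \<mu> R by (intro circle_mean_beurling_le) auto
  also have "\<dots> \<le> ln (2 * (1 / (R - 1)))"
  proof -
    have "R\<^sup>2 / (R\<^sup>2 - 1) = R\<^sup>2 / (R + 1) * (1 / (R - 1))"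
      by (simp add: power2_eq_square algebra_simps)
    moreover have "R\<^sup>2 / (R + 1) \<le> 2"
    proof -
      have "R * R \<le> 2 * R" using R by (intro mult_right_mono) auto
      then have "R\<^sup>2 \<le> 2 * (R + 1)" by (simp add: power2_eq_square)
      then show ?thesis using R by (simp add: divide_le_eq)
    qed
    then have "R\<^sup>2 / (R + 1) * (1 / (R - 1)) \<le> 2 * (1 / (R - 1))"
      using R by (intro mult_right_mono) auto
    ultimately show ?thesis
      using R by (intro ln_mono) auto
  qed
  also have "\<dots> = ln 2 + ln (1 / (R - 1))"
    using R by (intro ln_mult_pos) auto
  \<comment> \<open>Because R < 2, the logarithm of 1 / (R - 1) is nonnegative, so adding
    \<open>\<delta>\<close> times it only enlarges the bound.\<close>
  also have "\<dots> \<le> (1 + \<delta>) * ln (1 / (R - 1)) + ln 2"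
  proof -
    have "0 \<le> \<delta> * ln (1 / (R - 1))"
      using R \<delta> by (intro mult_nonneg_nonneg ln_ge_zero) auto
    then show ?thesis by (simp add: algebra_simps)
  qed
  finally show "(1 / (2 * pi)) * (LBINT \<theta>=0..2*pi. (cmod (beurling \<mu> (complex_of_real R * cis \<theta>)))\<^sup>2)
      \<le> (1 + \<delta>) * ln (1 / (R - 1)) + ln 2" .
qed

end
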